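(* For every integer $m\ge 0$ and every integer $k\ge 1$, one has, as polynomials in $x$ (i.e. for all $x\in\mathbb{C}_p$), \[ B_m^{(k)}(x)=\sum_{n=0}^{m}S_2(m,n)\,D_n^{(k)}(x). \]
   Context: Fix a prime $p$. $\mathbb{Z}_p$ is the ring of $p$-adic integers and $\mathbb{C}_p$ is the completion of an algebraic closure of $\mathbb{Q}_p$. For a uniformly differentiable function $f$ on $\mathbb{Z}_p$ (with values in $\mathbb{C}_p$), the $p$-adic invariant (Volkenborn) integral is $\int_{\mathbb{Z}_p}f(x)\,d\mu(x)=\lim_{N\to\infty}\frac{1}{p^N}\sum_{x=0}^{p^N-1}f(x)$. Write $(y)_n=y(y-1)\cdots(y-n+1)$ (with $(y)_0=1$). The Daehee polynomials (of the first kind) of order $k$ are defined by the $k$-fold iterated integral \[ D_n^{(k)}(x)=\int_{\mathbb{Z}_p}\cdots\int_{\mathbb{Z}_p}(x_1+\cdots+x_k+x)_n\,d\mu(x_1)\cdots d\mu(x_k). \] The Bernoulli polynomials of order $\alpha\in\mathbb{N}$ are defined by $\left(\frac{t}{e^t-1}\right)^{\alpha}e^{xt}=\sum_{n\ge0}B_n^{(\alpha)}(x)\frac{t^n}{n!}$. The Stirling numbers of the second kind $S_2(l,n)$ are defined by $(e^t-1)^n=n!\sum_{l\ge n}S_2(l,n)\frac{t^l}{l!}$. *)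

theory Defs
  imports
    "HOL-Analysis.Analysis"
    "HOL-Computational_Algebra.Computational_Algebra"
    "HOL-Combinatorics.Stirling"
begin

text \<open>
  The completion of an algebraic closure of the field of p-adic numbers, presented as a type carrying
  a complete absolute value.  The p-adic numbers are the closure of the rationals, since the absolute
  value restricts to the p-adic one on the rationals and the ambient type is complete.  An algebraic
  closure of this field inside the ambient field, if there is one, is necessarily the set of all
  elements algebraic over it, so it need not be a parameter.  The conditions determine the valued
  field up to isometric isomorphism.  The library's \<^const>\<open>norm\<close> is only usable on real
  vector spaces, so the absolute value is taken to be the distance from 0.
  The locale predicate takes the ambient type as an additional leading argument.
\<close>

definition padic_numbers :: "'a::{field_char_0, metric_space} set" where
  "padic_numbers = closure \<rat>"

definition padic_algebraic :: "'a::{field_char_0, metric_space} set" where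
  "padic_algebraic =
     {z. \<exists>P. P \<noteq> 0 \<and> (\<forall>i. coeff P i \<in> padic_numbers) \<and> poly P z = 0}"

definition absval :: "'a::{field_char_0, metric_space} \<Rightarrow> real" where
  "absval x = dist x 0"

locale padic_complex_field =
  fixes p :: nat
  assumes prime_p: "prime p"
    and dist_absval: "\<And>x y :: 'a::{field_char_0, complete_space}. dist x y = absval (x - y)"
    and absval_mult: "\<And>x y :: 'a. absval (x * y) = absval x * absval y"
    and absval_ultrametric: "\<And>x y :: 'a. absval (x + y) \<le> max (absval x) (absval y)"
    and absval_of_int:
      "\<And>n. n \<noteq> 0 \<Longrightarrow> absval (of_int n :: 'a) = 1 / real p ^ multiplicity (int p) n"
    and padic_algebraic_closed:
      "\<And>P :: 'a poly. (\<forall>i. coeff P i \<in> padic_algebraic) \<Longrightarrow> degree P > 0 \<Longrightarrow>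
         \<exists>z \<in> padic_algebraic. poly P z = 0"
    and padic_algebraic_dense: "closure (padic_algebraic :: 'a set) = UNIV"

text \<open>
  The Volkenborn integral over the p-adic integers only depends on the values at natural numbers, so
  the integrand may be given on the whole field.  The value is the limit whenever it exists, in
  particular for uniformly differentiable integrands such as polynomial functions.
\<close>

definition volkenborn :: "nat \<Rightarrow> ('a::{field_char_0, metric_space} \<Rightarrow> 'a) \<Rightarrow> 'a" where
  "volkenborn p f = lim (\<lambda>N. 1 / of_nat (p ^ N) * (\<Sum>x<p ^ N. f (of_nat x)))"

text \<open>The integrand takes the list \<open>[x\<^sub>1, \<dots>, x\<^sub>k]\<close>; the innermost integration is over \<open>x\<^sub>1\<close>.\<close>

primrec volkenborn_iter ::
    "nat \<Rightarrow> nat \<Rightarrow> ('a::{field_char_0, metric_space} list \<Rightarrow> 'a) \<Rightarrow> 'a" where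
  "volkenborn_iter p 0 f = f []"
| "volkenborn_iter p (Suc k) f = volkenborn p (\<lambda>y. volkenborn_iter p k (\<lambda>ys. f (ys @ [y])))"

definition falling_factorial :: "'a::comm_ring_1 \<Rightarrow> nat \<Rightarrow> 'a" where
  "falling_factorial y n = (\<Prod>i<n. y - of_nat i)"

definition daehee_poly :: "nat \<Rightarrow> nat \<Rightarrow> nat \<Rightarrow> 'a::{field_char_0, metric_space} \<Rightarrow> 'a" where
  "daehee_poly p k n x = volkenborn_iter p k (\<lambda>xs. falling_factorial (sum_list xs + x) n)"

definition bernoulli_poly :: "nat \<Rightarrow> nat \<Rightarrow> 'a::field_char_0 \<Rightarrow> 'a" where
  "bernoulli_poly \<alpha> n x =
     fact n * fps_nth ((fps_X / (fps_exp 1 - 1)) ^ \<alpha> * fps_exp x) n"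

text \<open>
  The library defines \<^const>\<open>Stirling\<close> by its recurrence; it satisfies the generating function
  identity that defines the Stirling numbers of the second kind.
\<close>

lemma Stirling_egf:
  "(fps_exp 1 - 1 :: 'a::field_char_0 fps) ^ n =
     fps_const (fact n) * Abs_fps (\<lambda>l. of_nat (Stirling l n) / fact l)"
proof -
  have S: "fact l * fps_nth ((fps_exp 1 - 1 :: 'a fps) ^ n) l = fact n * of_nat (Stirling l n)" for l
  proof (induction l arbitrary: n)
    case 0
    show ?case by (cases n) (simp_all add: fps_power_zeroth)
  next
    case (Suc l)
    show ?case
    proof (cases n)
      case 0
      then show ?thesis by simp
    next
      case n: (Suc j)
      let ?E = "fps_exp 1 - 1 :: 'a fps"
      have d: "fps_deriv (?E ^ n) = of_nat n * (?E ^ n + ?E ^ j)"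
      proof -
        have "fps_deriv (?E ^ n) = of_nat n * fps_deriv ?E * ?E ^ j"
          by (simp only: n fps_deriv_power' diff_Suc_1)
        also have "fps_deriv ?E = ?E + 1"
          by simp
        also have "of_nat n * (?E + 1) * ?E ^ j = of_nat n * (?E ^ n + ?E ^ j)"
          by (simp only: n power_Suc distrib_left distrib_right mult.assoc mult_1_left)
        finally show ?thesis .
      qed
      have "fact (Suc l) * fps_nth (?E ^ n) (Suc l) = fact l * fps_nth (fps_deriv (?E ^ n)) l"
        by (simp add: fps_deriv_nth algebra_simps)
      also have "\<dots> = of_nat n * (fact l * fps_nth (?E ^ n) l + fact l * fps_nth (?E ^ j) l)"
        unfolding d fps_of_nat[symmetric] fps_mult_left_const_nth fps_add_nth
        by (simp only: algebra_simps)
      also have "\<dots> = of_nat n * (fact n * of_nat (Stirling l n) + fact j * of_nat (Stirling l j))"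
        by (simp only: Suc.IH)
      also have "\<dots> = fact n * of_nat (Stirling (Suc l) n)"
        by (simp add: n algebra_simps)
      finally show ?thesis .
    qed
  qed
  show ?thesis
    by (rule fps_ext) (use S in \<open>simp add: field_simps\<close>)
qed

end

theory Submission imports Defs begin

text \<open>
  With \<open>G = t / (e\<^sup>t - 1)\<close>, summing a geometric series gives
  \<open>(1/M) \<Sum>\<^bsub>j<M\<^esub> G\<^sup>k e\<^bsup>(j+x)t\<^esup> = G\<^bsup>k+1\<^esup> e\<^bsup>xt\<^esup> (e\<^bsup>Mt\<^esup> - 1)/(Mt)\<close>,
  whose coefficients are polynomials in \<open>M\<close>.  As \<open>M = p\<^sup>N\<close> tends to 0 in the p-adic
  topology, only their constant terms survive, so the Volkenborn integral of
  \<open>y \<mapsto> B\<^sub>n\<^bsup>(k)\<^esup>(y + x)\<close> is \<open>B\<^sub>n\<^bsup>(k+1)\<^esup>(x)\<close>.  By iteration, the \<open>k\<close>-fold integral of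
  \<open>P(x\<^sub>1 + \<dots> + x\<^sub>k + x)\<close> for a polynomial \<open>P\<close> replaces each power \<open>X\<^sup>n\<close> by
  \<open>B\<^sub>n\<^bsup>(k)\<^esup>(x)\<close>; applying this to \<open>X\<^sup>m = \<Sum>\<^sub>n S\<^sub>2(m,n) (X)\<^sub>n\<close> gives the claim.
\<close>

lemma absval_0: "absval (0 :: 'a::{field_char_0, metric_space}) = 0"
  by (simp add: absval_def)

lemma absval_nonneg: "absval (x :: 'a::{field_char_0, metric_space}) \<ge> 0"
  by (simp add: absval_def)

lemma absval_prime_power:
  assumes "padic_complex_field TYPE('a::{field_char_0, complete_space}) p"
  shows "absval (of_nat (p ^ N) :: 'a) = (1 / real p) ^ N"
proof -
  have p: "prime (int p)"
    using padic_complex_field.prime_p[OF assms] by simp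
  hence "multiplicity (int p) (int p ^ N) = N"
    by (intro multiplicity_same_power) auto
  moreover have "int p ^ N \<noteq> 0"
    using p by auto
  ultimately show ?thesis
    using padic_complex_field.absval_of_int[OF assms, of "int p ^ N"]
    by (simp add: power_one_over)
qed

text \<open>The unit ball of C_p is not compact, so the bound comes from Horner's scheme instead:
  multiplying by \<open>z\<close> does not increase the absolute value, and adding a coefficient is
  controlled by the ultrametric inequality.\<close>

lemma absval_poly_bounded:
  assumes "padic_complex_field TYPE('a::{field_char_0, complete_space}) p"
  obtains C where "\<And>z :: 'a. absval z \<le> 1 \<Longrightarrow> absval (poly P z) \<le> C"
proof -
  have "\<exists>C. \<forall>z :: 'a. absval z \<le> 1 \<longrightarrow> absval (poly P z) \<le> C"
  proof (induction P)
    case 0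
    show ?case by (auto simp: absval_0)
  next
    case (pCons a P)
    then obtain C where C: "\<And>z :: 'a. absval z \<le> 1 \<Longrightarrow> absval (poly P z) \<le> C"
      by blast
    have "absval (poly (pCons a P) z) \<le> max (absval a) C" if z: "absval z \<le> 1" for z :: 'a
    proof -
      have "absval (z * poly P z) \<le> absval (poly P z)"
        using mult_right_mono[OF z absval_nonneg[of "poly P z"]]
        by (simp add: padic_complex_field.absval_mult[OF assms])
      with C[OF z] show ?thesis
        using padic_complex_field.absval_ultrametric[OF assms, of a "z * poly P z"] by auto
    qed
    thus ?case by blast
  qed
  thus ?thesis using that by blast
qed

text \<open>With P = a + X Q, the distance from P(p^N) to a is p^(-N) times the absolute value of
  Q(p^N), and Q is bounded on the unit ball.\<close>

lemma poly_prime_power_tendsto: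
  assumes "padic_complex_field TYPE('a::{field_char_0, complete_space}) p"
  shows "(\<lambda>N. poly P (of_nat (p ^ N) :: 'a)) \<longlonglongrightarrow> coeff P 0"
proof (cases P)
  case (pCons a Q)
  obtain C where C: "\<And>z :: 'a. absval z \<le> 1 \<Longrightarrow> absval (poly Q z) \<le> C"
    using absval_poly_bounded[OF assms] by blast
  have p: "real p > 1"
    using padic_complex_field.prime_p[OF assms] prime_gt_1_nat by simp
  have bound: "dist (poly P (of_nat (p ^ N))) (coeff P 0) \<le> (1 / real p) ^ N * C" for N
  proof -
    have M: "absval (of_nat (p ^ N) :: 'a) = (1 / real p) ^ N"
      by (rule absval_prime_power[OF assms])
    have "dist (poly P (of_nat (p ^ N))) (coeff P 0) =
            (1 / real p) ^ N * absval (poly Q (of_nat (p ^ N)))"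
      unfolding padic_complex_field.dist_absval[OF assms] M[symmetric]
        padic_complex_field.absval_mult[OF assms, symmetric]
      by (simp add: pCons)
    also have "\<dots> \<le> (1 / real p) ^ N * C"
      using p by (intro mult_left_mono C) (auto simp: M power_le_one simp del: of_nat_power)
    finally show ?thesis .
  qed
  have "(\<lambda>N. (1 / real p) ^ N * C) \<longlonglongrightarrow> 0"
    using p by (intro tendsto_mult_left_zero LIMSEQ_power_zero) auto
  hence "(\<lambda>N. dist (poly P (of_nat (p ^ N))) (coeff P 0)) \<longlonglongrightarrow> 0"
    by (rule Lim_null_comparison[rotated]) (use bound in auto)
  thus ?thesis by (rule tendsto_dist_iff[THEN iffD2])
qed

text \<open>The factor \<open>of_nat M\<close> cancels the normalization 1/p^N, so the averages are
  exactly the values of \<open>Q\<close> at p^N.\<close>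

lemma volkenborn_eqI:
  assumes "padic_complex_field TYPE('a::{field_char_0, complete_space}) p"
    and "\<And>M. M > 0 \<Longrightarrow> (\<Sum>j<M. f (of_nat j :: 'a)) = of_nat M * poly Q (of_nat M)"
  shows "volkenborn p f = coeff Q 0"
proof -
  have "p > 0"
    using padic_complex_field.prime_p[OF assms(1)] prime_gt_0_nat by blast
  hence "1 / of_nat (p ^ N) * (\<Sum>j<p ^ N. f (of_nat j)) = poly Q (of_nat (p ^ N))" for N
    by (subst assms(2)) auto
  thus ?thesis
    unfolding volkenborn_def using poly_prime_power_tendsto[OF assms(1), of Q]
    by (simp add: limI)
qed

text \<open>Division of power series need not be exact; here it is, because e^t - 1 has subdegree 1
  and hence divides t.\<close>

lemma fps_bernoulli_mult: "fps_X / (fps_exp 1 - 1) * (fps_exp 1 - 1 :: 'a::field_char_0 fps) = fps_X"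
proof -
  have "fps_nth (fps_exp 1 - 1 :: 'a fps) 1 \<noteq> 0" by simp
  hence "subdegree (fps_exp 1 - 1 :: 'a fps) = 1"
    by (intro subdegreeI) auto
  moreover have "fps_exp 1 - 1 \<noteq> (0 :: 'a fps)"
    using \<open>fps_nth (fps_exp 1 - 1 :: 'a fps) 1 \<noteq> 0\<close> by force
  ultimately show ?thesis
    by (intro dvd_div_mult_self) (simp add: fps_dvd_iff)
qed

lemma sum_fps_bernoulli_exp:
  fixes x :: "'a::field_char_0"
  defines "G \<equiv> fps_X / (fps_exp 1 - 1 :: 'a fps)"
  shows "(\<Sum>j<M. G ^ k * fps_exp (of_nat j + x)) =
    fps_const (of_nat M) * (G ^ Suc k * fps_exp x * Abs_fps (\<lambda>r. of_nat M ^ r / fact (Suc r)))"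
proof -
  \<comment> \<open>The series (e^(Mt) - 1)/(Mt) is given by its coefficients, which keeps the
    identity valid for M = 0.\<close>
  have e: "fps_exp (of_nat M) - 1 =
      fps_X * (fps_const (of_nat M) * Abs_fps (\<lambda>r. of_nat M ^ r / fact (Suc r)) :: 'a fps)"
  proof (rule fps_ext)
    fix n show "fps_nth (fps_exp (of_nat M) - 1) n = fps_nth (fps_X * (fps_const (of_nat M) * 
       Abs_fps (\<lambda>r. of_nat M ^ r / fact (Suc r)) :: 'a fps)) n"
      by (cases n) (simp_all del: fact_Suc)
  qed
  \<comment> \<open>Writing t as G (e^t - 1) does two things: G raises the order to k + 1, and e^t -
    1 telescopes the geometric sum.\<close>
  have "fps_X * (\<Sum>j<M. G ^ k * fps_exp (of_nat j + x)) =
     (G * (fps_exp 1 - 1)) * (\<Sum>j<M. G ^ k * fps_exp (of_nat j + x))"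
    by (simp only: G_def fps_bernoulli_mult)
  also have "\<dots> = G ^ Suc k * fps_exp x * ((fps_exp 1 - 1) * (\<Sum>j<M. fps_exp 1 ^ j))"
    by (simp only: fps_exp_add_mult fps_exp_power_mult mult_1_left mult_1_right sum_distrib_left power_Suc mult_ac)
  also have "(fps_exp 1 - 1) * (\<Sum>j<M. fps_exp 1 ^ j) = (fps_exp (of_nat M) - 1 :: 'a fps)"
    unfolding power_diff_1_eq[symmetric] by (simp only: fps_exp_power_mult mult_1_right)
  finally have "fps_X * (\<Sum>j<M. G ^ k * fps_exp (of_nat j + x)) = fps_X * (fps_const (of_nat M) *
     (G ^ Suc k * fps_exp x * Abs_fps (\<lambda>r. of_nat M ^ r / fact (Suc r))))"
    unfolding e by (simp only: mult_ac)
  thus ?thesis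
    by (simp only: mult_cancel_left fps_X_neq_zero simp_thms)
qed

text \<open>A Faulhaber formula of higher order. What matters is that one \<open>Q\<close> serves
  all \<open>M\<close>.\<close>

lemma sum_bernoulli_poly:
  fixes x :: "'a::field_char_0"
  obtains Q where "coeff Q 0 = bernoulli_poly (Suc k) n x"
    and "\<And>M. (\<Sum>j<M. bernoulli_poly k n (of_nat j + x)) = of_nat M * poly Q (of_nat M)"
proof
  define G where "G = fps_X / (fps_exp 1 - 1 :: 'a fps)"
  \<comment> \<open>The Cauchy product for the coefficient of t^n, sorted by powers of M; the term r
    = 0 is the Bernoulli polynomial of order k + 1.\<close>
  define Q where "Q = (\<Sum>r\<le>n. monom (fact n * fps_nth (G ^ Suc k * fps_exp x) (n - r) / fact (Suc r)) r)"
  show "coeff Q 0 = bernoulli_poly (Suc k) n x"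
    by (simp add: Q_def coeff_sum bernoulli_poly_def G_def[symmetric])
  fix M
  have "(\<Sum>j<M. bernoulli_poly k n (of_nat j + x)) =
      fact n * fps_nth (\<Sum>j<M. G ^ k * fps_exp (of_nat j + x)) n"
    by (simp add: bernoulli_poly_def G_def fps_sum_nth sum_distrib_left)
  also have "\<dots> = of_nat M * (fact n * fps_nth (Abs_fps (\<lambda>r. of_nat M ^ r / fact (Suc r)) * (G ^ Suc k * fps_exp x)) n)"
    unfolding G_def sum_fps_bernoulli_exp fps_mult_left_const_nth by (simp only: mult_ac)
  also have "fact n * fps_nth (Abs_fps (\<lambda>r. of_nat M ^ r / fact (Suc r)) * (G ^ Suc k * fps_exp x)) n
      = poly Q (of_nat M)"
    unfolding fps_mult_nth[of "Abs_fps _"] Q_def poly_sum poly_monom sum_distrib_left atLeast0AtMost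
    by (intro sum.cong refl) simp
  finally show "(\<Sum>j<M. bernoulli_poly k n (of_nat j + x)) = of_nat M * poly Q (of_nat M)" .
qed

text \<open>Since \<open>lim\<close> is additive only on convergent sequences, the linear
  combination is formed among the polynomials \<open>Q n\<close>, before any limit is taken.\<close>

lemma volkenborn_sum_bernoulli_poly:
  fixes x :: "'a::{field_char_0, complete_space}"
  assumes "padic_complex_field TYPE('a) p"
  shows "volkenborn p (\<lambda>y. \<Sum>n\<in>I. c n * bernoulli_poly k n (y + x)) =
    (\<Sum>n\<in>I. c n * bernoulli_poly (Suc k) n x)"
proof -
  have "\<forall>n. \<exists>Q. coeff Q 0 = bernoulli_poly (Suc k) n x \<and>
      (\<forall>M. (\<Sum>j<M. bernoulli_poly k n (of_nat j + x)) = of_nat M * poly Q (of_nat M))"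
    using sum_bernoulli_poly by metis
  then obtain Q where Q0: "\<And>n. coeff (Q n) 0 = bernoulli_poly (Suc k) n x"
    and Q: "\<And>n M. (\<Sum>j<M. bernoulli_poly k n (of_nat j + x)) = of_nat M * poly (Q n) (of_nat M)"
    by metis
  have "(\<Sum>j<M. \<Sum>n\<in>I. c n * bernoulli_poly k n (of_nat j + x)) =
      of_nat M * poly (\<Sum>n\<in>I. smult (c n) (Q n)) (of_nat M)" for M
  proof -
    have "(\<Sum>j<M. \<Sum>n\<in>I. c n * bernoulli_poly k n (of_nat j + x)) =
        (\<Sum>n\<in>I. c n * (\<Sum>j<M. bernoulli_poly k n (of_nat j + x)))"
      by (subst sum.swap) (simp only: sum_distrib_left)
    thus ?thesis
      unfolding Q by (simp add: poly_sum sum_distrib_left mult_ac)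
  qed
  from volkenborn_eqI[OF assms this] show ?thesis
    by (simp add: coeff_sum Q0)
qed

lemma bernoulli_poly_0: "bernoulli_poly 0 n x = x ^ n"
  by (simp add: bernoulli_poly_def)

text \<open>The bound \<open>m\<close> in place of the degree lets polynomials of different degrees
  share one range of summation.\<close>

lemma volkenborn_iter_poly:
  fixes x :: "'a::{field_char_0, complete_space}"
  assumes "padic_complex_field TYPE('a) p" and "degree P \<le> m"
  shows "volkenborn_iter p k (\<lambda>xs. poly P (sum_list xs + x)) =
    (\<Sum>n\<le>m. coeff P n * bernoulli_poly k n x)"
proof (induction k arbitrary: x)
  case 0
  have "(\<Sum>n\<le>m. coeff P n * x ^ n) = poly P x"
    unfolding poly_altdef
    by (rule sum.mono_neutral_right) (use assms(2) in \<open>auto simp: coeff_eq_0\<close>)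
  thus ?case
    by (simp add: bernoulli_poly_0)
next
  case (Suc k)
  \<comment> \<open>The outermost variable y is absorbed into the shift: the induction hypothesis is
    used at y + x.\<close>
  show ?case
    using Suc.IH volkenborn_sum_bernoulli_poly[OF assms(1), of "coeff P" k x "{..m}"]
    by (simp add: add.assoc)
qed

definition falling_factorial_poly :: "nat \<Rightarrow> 'a::comm_ring_1 poly" where
  "falling_factorial_poly n = (\<Prod>i<n. [:- of_nat i, 1:])"

lemma poly_falling_factorial_poly: "poly (falling_factorial_poly n) y = falling_factorial y n"
  by (simp add: falling_factorial_poly_def falling_factorial_def poly_prod)

lemma degree_falling_factorial_poly:
  "degree (falling_factorial_poly n :: 'a::comm_ring_1 poly) \<le> n"
proof -
  have "degree (falling_factorial_poly n :: 'a poly) \<le> (\<Sum>i<n. degree [:- of_nat i, 1 :: 'a:])"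
    unfolding falling_factorial_poly_def by (rule degree_prod_sum_le[OF finite_lessThan, unfolded o_def])
  thus ?thesis by simp
qed

text \<open>The rule X (X)_n = (X)_(n+1) + n (X)_n mirrors the recurrence of the Stirling
  numbers.\<close>

lemma monom_eq_sum_Stirling:
  "monom 1 m = (\<Sum>n\<le>m. smult (of_nat (Stirling m n)) (falling_factorial_poly n :: 'a::comm_ring_1 poly))"
proof (induction m)
  case 0
  show ?case by (simp add: falling_factorial_poly_def)
next
  case (Suc m)
  let ?F = "falling_factorial_poly :: nat \<Rightarrow> 'a poly"
  have F: "[:0, 1:] * ?F n = ?F (Suc n) + smult (of_nat n) (?F n)" for n
    by (simp add: falling_factorial_poly_def algebra_simps)
  have "monom 1 (Suc m) = [:0, 1:] * monom (1 :: 'a) m"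
    by (simp add: monom_Suc)
  also have "\<dots> = (\<Sum>n\<le>m. smult (of_nat (Stirling m n)) ([:0, 1:] * ?F n))"
    unfolding Suc.IH sum_distrib_left by simp
  also have "\<dots> = (\<Sum>n\<le>m. smult (of_nat (Stirling m n)) (?F (Suc n))) +
      (\<Sum>n\<le>m. smult (of_nat (n * Stirling m n)) (?F n))"
    unfolding F by (simp add: smult_add_right sum.distrib mult_ac)
  \<comment> \<open>The added term vanishes because \<open>Stirling m (Suc m)\<close> is 0; in the
    next step the term n = 0 drops out through its factor n.\<close>
  also have "(\<Sum>n\<le>m. smult (of_nat (n * Stirling m n)) (?F n)) =
      (\<Sum>n\<le>Suc m. smult (of_nat (n * Stirling m n)) (?F n))"
    by simp
  also have "\<dots> = (\<Sum>n\<le>m. smult (of_nat (Suc n * Stirling m (Suc n))) (?F (Suc n)))"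
    by (subst sum.atMost_Suc_shift) simp
  also have "(\<Sum>n\<le>m. smult (of_nat (Stirling m n)) (?F (Suc n))) + \<dots> =
      (\<Sum>n\<le>m. smult (of_nat (Stirling (Suc m) (Suc n))) (?F (Suc n)))"
    by (simp add: sum.distrib[symmetric] smult_add_left[symmetric] algebra_simps)
  also have "\<dots> = (\<Sum>n\<le>Suc m. smult (of_nat (Stirling (Suc m) n)) (?F n))"
    by (subst sum.atMost_Suc_shift) simp
  finally show ?case .
qed

theorem theorem7:
  fixes p m k :: nat
    and x :: "'a::{field_char_0, complete_space}"
  assumes "padic_complex_field TYPE('a) p"
    and "k \<ge> 1"
  shows "bernoulli_poly k m x = (\<Sum>n=0..m. of_nat (Stirling m n) * daehee_poly p k n x)"
proof -
  let ?F = "falling_factorial_poly :: nat \<Rightarrow> 'a poly"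
  have D: "daehee_poly p k n x = (\<Sum>j\<le>m. coeff (?F n) j * bernoulli_poly k j x)" if "n \<le> m" for n
    unfolding daehee_poly_def poly_falling_factorial_poly[symmetric]
    using that degree_falling_factorial_poly[of n]
    by (intro volkenborn_iter_poly[OF assms(1)]) (rule order.trans)
  have "(\<Sum>n=0..m. of_nat (Stirling m n) * daehee_poly p k n x) =
      (\<Sum>n\<le>m. \<Sum>j\<le>m. of_nat (Stirling m n) * coeff (?F n) j * bernoulli_poly k j x)"
    by (simp add: atLeast0AtMost D sum_distrib_left mult.assoc)
  \<comment> \<open>Collecting the coefficients of X^j first makes the Stirling expansion of X^m
    appear.\<close>
  also have "\<dots> = (\<Sum>j\<le>m. coeff (\<Sum>n\<le>m. smult (of_nat (Stirling m n)) (?F n)) j * bernoulli_poly k j x)"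
    by (subst sum.swap) (simp add: coeff_sum sum_distrib_right)
  also have "\<dots> = (\<Sum>j\<le>m. if m = j then bernoulli_poly k j x else 0)"
    unfolding monom_eq_sum_Stirling[symmetric] by (intro sum.cong) auto
  also have "\<dots> = bernoulli_poly k m x"
    by simp
  finally show ?thesis ..
qed

end
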